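(* Let $b\ge 2$, $s\ge 2$, $u\ge 0$ and $m$ be integers, let $\boldsymbol{e}=(e_1,\ldots,e_s)\in\mathbb{N}^s$ with $e_1\le e_2\le\cdots\le e_s$, and suppose $m\ge u+e_s$. Then the existence of a $(u,m,\boldsymbol{e},s)$-net in base $b$ is equivalent to the existence of a mixed ordered orthogonal array $$\mathrm{OOA}\left(b^m,(\beta_1,\ldots,\beta_s),l_1^1\cdots l_s^1,m-u\right)$$ with $l_i=b^{e_i}$ and $\beta_i = \lfloor (m-u)/e_i \rfloor$ for $1 \le i \le s$.
   Context: $\mathbb{N}$ denotes the set of positive integers, $\lambda_s$ the $s$-dimensional Lebesgue measure, and $R(l)=\{0,1,\ldots,l-1\}\subset\mathbb{Z}$ for every integer $l\ge 2$. Elementary interval: for integers $b\ge 2$, $s\ge 1$, an interval $J\subseteq[0,1)^s$ is an elementary interval in base $b$ if $J=\prod_{i=1}^s [a_ib^{-d_i},(a_i+1)b^{-d_i})$ with integers $d_i\ge 0$ and $0\le a_i<b^{d_i}$ for $1\le i\le s$. $(u,m,\boldsymbol{e},s)$-net: let $b\ge 2$, $s\ge 1$, $0\le u\le m$ be integers and $\boldsymbol{e}=(e_1,\ldots,e_s)\in\mathbb{N}^s$. A point set $\mathcal{P}$ of $b^m$ points in $[0,1)^s$ (an indexed family; points are counted with multiplicity) is a $(u,m,\boldsymbol{e},s)$-net in base $b$ if every elementary interval $J=\prod_{i=1}^s [a_ib^{-d_i},(a_i+1)b^{-d_i})$ in base $b$, with integers $d_i\ge 0$, $0\le a_i<b^{d_i}$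 and $e_i\mid d_i$ for $1\le i\le s$ and with volume $\lambda_s(J)\ge b^{u-m}$, contains exactly $b^m\lambda_s(J)$ points of $\mathcal{P}$. Mixed ordered orthogonal array: let $\beta_1,\ldots,\beta_s$ be positive integers with $\beta_i\le\lfloor (m-u)/e_i\rfloor$ and let $l_i=b^{e_i}$ for $1\le i\le s$. A mixed ordered orthogonal array $\mathrm{OOA}(b^m,(\beta_1,\ldots,\beta_s),l_1^1\cdots l_s^1,m-u)$ (of strength $m-u$) is a $b^m\times(\beta_1+\cdots+\beta_s)$ array $Z=(z_{i,\rho_i}(n))_{1\le n\le b^m;\,1\le i\le s,\,1\le\rho_i\le\beta_i}$, with rows indexed by $n$, columns $\boldsymbol{z}_{i,\rho_i}$ indexed by the pairs $(i,\rho_i)$, and entries $z_{i,\rho_i}(n)\in R(b^{e_i})$, satisfying the following condition: for every $t\in\{1,\ldots,s\}$, all indices $1\le i_1<\cdots<i_t\le s$, and all positive integers $\kappa_{i_1},\ldots,\kappa_{i_t}$ with $\kappa_{i_j}\le\beta_{i_j}$ for $1\le j\le t$ and $\sum_{j=1}^t\kappa_{i_j}e_{i_j}\le m-u$, in the subarray of $Z$ formed by the columns $$\boldsymbol{z}_{i_1,1},\ldots,\boldsymbol{z}_{i_1,\kappa_{i_1}},\ldots,\boldsymbol{z}_{i_t,1},\ldots,\boldsymbol{z}_{i_t,\kappa_{i_t}}$$ each tuple in $(R(b^{e_{i_1}}))^{\kappa_{i_1}}\times\cdots\times(R(b^{e_{i_t}}))^{\kappa_{i_t}}$ occurs as a row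 exactly $b^m b^{-\kappa_{i_1}e_{i_1}-\cdots-\kappa_{i_t}e_{i_t}}$ times. *)

theory Defs
  imports "HOL-Analysis.Analysis"
begin

text \<open>
  Points of \<open>\<real>\<^sup>s\<close> are extensional functions on the index set \<open>{1..s}\<close>, so that
  the dimension \<open>s\<close> is an ordinary natural number and the order of the coordinates is available.
\<close>

definition unit_cube :: "nat \<Rightarrow> (nat \<Rightarrow> real) set" where
  "unit_cube s = (\<Pi>\<^sub>E i\<in>{1..s}. {0..<1})"

definition lebesgue_vol :: "nat \<Rightarrow> (nat \<Rightarrow> real) set \<Rightarrow> real" where
  "lebesgue_vol s A = measure (\<Pi>\<^sub>M i\<in>{1..s}. lborel) A"

definition elementary_interval ::
    "nat \<Rightarrow> nat \<Rightarrow> (nat \<Rightarrow> nat) \<Rightarrow> (nat \<Rightarrow> nat) \<Rightarrow> (nat \<Rightarrow> real) set" where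
  "elementary_interval b s d a =
     (\<Pi>\<^sub>E i\<in>{1..s}. {real (a i) / real b ^ d i ..< (real (a i) + 1) / real b ^ d i})"

text \<open>
  The family \<open>P\<close> is indexed by \<open>{1..b ^ m}\<close>; counting indices rather than points accounts for
  multiplicities.
\<close>

definition is_net ::
    "nat \<Rightarrow> nat \<Rightarrow> (nat \<Rightarrow> nat) \<Rightarrow> nat \<Rightarrow> nat \<Rightarrow> (nat \<Rightarrow> nat \<Rightarrow> real) \<Rightarrow> bool" where
  "is_net u m e s b P \<longleftrightarrow>
     b \<ge> 2 \<and> s \<ge> 1 \<and> u \<le> m \<and> (\<forall>i\<in>{1..s}. e i \<ge> 1) \<and>
     (\<forall>n\<in>{1..b ^ m}. P n \<in> unit_cube s) \<and>
     (\<forall>d a. (\<forall>i\<in>{1..s}. a i < b ^ d i \<and> e i dvd d i) \<longrightarrow>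
        lebesgue_vol s (elementary_interval b s d a) \<ge> real b powi (int u - int m) \<longrightarrow>
        real (card {n\<in>{1..b ^ m}. P n \<in> elementary_interval b s d a}) =
          real b ^ m * lebesgue_vol s (elementary_interval b s d a))"

definition R :: "nat \<Rightarrow> int set" where
  "R l = {0..<int l}"

text \<open>
  \<open>Z i \<rho> n\<close> is the entry in row \<open>n\<close> of the column indexed by \<open>(i, \<rho>)\<close>; the values of \<open>Z\<close> outside
  the index ranges are irrelevant. A choice of \<open>t \<in> {1..s}\<close> and \<open>i\<^sub>1 < \<dots> < i\<^sub>t\<close> is the same
  as a nonempty set \<open>I \<subseteq> {1..s}\<close>, and a tuple over the selected columns is a
  family \<open>c i \<rho>\<close> with \<open>i \<in> I\<close> and \<open>1 \<le> \<rho> \<le> \<kappa> i\<close>. The strength is \<open>m - u\<close>.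
\<close>

definition is_mixed_OOA ::
    "nat \<Rightarrow> nat \<Rightarrow> nat \<Rightarrow> (nat \<Rightarrow> nat) \<Rightarrow> nat \<Rightarrow> (nat \<Rightarrow> nat) \<Rightarrow>
     (nat \<Rightarrow> nat \<Rightarrow> nat \<Rightarrow> int) \<Rightarrow> bool" where
  "is_mixed_OOA b m u e s \<beta> Z \<longleftrightarrow>
     b \<ge> 2 \<and> s \<ge> 1 \<and> u \<le> m \<and> (\<forall>i\<in>{1..s}. e i \<ge> 1) \<and>
     (\<forall>i\<in>{1..s}. 1 \<le> \<beta> i \<and> \<beta> i \<le> (m - u) div e i) \<and>
     (\<forall>i\<in>{1..s}. \<forall>\<rho>\<in>{1..\<beta> i}. \<forall>n\<in>{1..b ^ m}. Z i \<rho> n \<in> R (b ^ e i)) \<and>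
     (\<forall>I \<kappa>. I \<noteq> {} \<longrightarrow> I \<subseteq> {1..s} \<longrightarrow>
        (\<forall>i\<in>I. 1 \<le> \<kappa> i \<and> \<kappa> i \<le> \<beta> i) \<longrightarrow> (\<Sum>i\<in>I. \<kappa> i * e i) \<le> m - u \<longrightarrow>
        (\<forall>c. (\<forall>i\<in>I. \<forall>\<rho>\<in>{1..\<kappa> i}. c i \<rho> \<in> R (b ^ e i)) \<longrightarrow>
           real (card {n\<in>{1..b ^ m}. \<forall>i\<in>I. \<forall>\<rho>\<in>{1..\<kappa> i}. Z i \<rho> n = c i \<rho>}) =
             real b ^ m / real b ^ (\<Sum>i\<in>I. \<kappa> i * e i)))"

end

theory Submission
  imports Defs
begin

text \<open>
  Write \<open>B\<^sub>i = b ^ e\<^sub>i\<close> and expand the \<open>i\<close>-th coordinate of a point in base \<open>B\<^sub>i\<close>.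
  An elementary interval whose exponents are \<open>d\<^sub>i = \<kappa>\<^sub>i e\<^sub>i\<close> fixes exactly the first \<open>\<kappa>\<^sub>i\<close>
  base-\<open>B\<^sub>i\<close> digits of the \<open>i\<close>-th coordinate, and every choice of these digits comes from exactly one
  such interval. Its volume is \<open>b\<close> to the power \<open>- \<Sum>i. \<kappa>\<^sub>i e\<^sub>i\<close>, so the volume bound of a net is the
  bound \<open>(\<Sum>i. \<kappa>\<^sub>i e\<^sub>i) \<le> m - u\<close> of an orthogonal array, and the two prescribed counts agree.
  Hence a point family and the array of its digits satisfy the same counting condition
  (\<open>is_net_iff_is_mixed_OOA\<close>).

  Since \<open>\<kappa>\<^sub>i e\<^sub>i \<le> m - u\<close>, only the first \<open>\<lfloor>(m - u) / e\<^sub>i\<rfloor>\<close> digits are ever inspected. A net therefore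
  yields an array by reading off these digits, and an array yields a net by taking its entries
  as the digits of finite expansions. The counting condition is brought to a common form for both
  sides in \<open>is_net_iff_floor_counts\<close> and \<open>is_mixed_OOA_iff_full_counts\<close>.
\<close>

section \<open>Finite digit expansions\<close>

text \<open>
  The digits \<open>f 1, \<dots>, f k\<close> are read with the most significant one first, as for the digits after
  the radix point: \<open>digits_value B f k / B ^ k\<close> is the fraction \<open>0.f(1)f(2)\<dots>f(k)\<close>.
\<close>

primrec digits_value :: "nat \<Rightarrow> (nat \<Rightarrow> int) \<Rightarrow> nat \<Rightarrow> int" where
  "digits_value B f 0 = 0"
| "digits_value B f (Suc k) = digits_value B f k * int B + f (Suc k)"

lemma digits_value_cong:
  assumes "\<And>\<rho>. \<rho> \<in> {1..k} \<Longrightarrow> f \<rho> = g \<rho>"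
  shows "digits_value B f k = digits_value B g k"
  using assms by (induction k) auto

lemma digits_value_bounds:
  assumes "\<forall>\<rho>\<in>{1..k}. f \<rho> \<in> R B"
  shows "0 \<le> digits_value B f k \<and> digits_value B f k < int B ^ k"
  using assms
proof (induction k)
  case (Suc k)
  then have IH: "0 \<le> digits_value B f k" "digits_value B f k + 1 \<le> int B ^ k"
    and f: "0 \<le> f (Suc k)" "f (Suc k) < int B"
    by (auto simp: R_def)
  have "(digits_value B f k + 1) * int B \<le> int B ^ k * int B"
    using IH(2) by (intro mult_right_mono) auto
  with IH f show ?case by (auto simp: algebra_simps)
qed simp

lemma digits_value_eq_iff:
  assumes "\<forall>\<rho>\<in>{1..k}. f \<rho> \<in> R B" and "\<forall>\<rho>\<in>{1..k}. g \<rho> \<in> R B"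
  shows "digits_value B f k = digits_value B g k \<longleftrightarrow> (\<forall>\<rho>\<in>{1..k}. f \<rho> = g \<rho>)"
  using assms
proof (induction k)
  case (Suc k)
  have f: "0 \<le> f (Suc k)" "f (Suc k) < int B" and g: "0 \<le> g (Suc k)" "g (Suc k) < int B"
    using Suc.prems by (auto simp: R_def)
  have "digits_value B f (Suc k) = digits_value B g (Suc k) \<longleftrightarrow>
        digits_value B f k = digits_value B g k \<and> f (Suc k) = g (Suc k)"
  proof
    assume eq: "digits_value B f (Suc k) = digits_value B g (Suc k)"
    from arg_cong[OF eq, of "\<lambda>v. v div int B"] arg_cong[OF eq, of "\<lambda>v. v mod int B"] f g
    show "digits_value B f k = digits_value B g k \<and> f (Suc k) = g (Suc k)"
      by simp
  qed simp
  also have "\<dots> \<longleftrightarrow> (\<forall>\<rho>\<in>{1..Suc k}. f \<rho> = g \<rho>)"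
    using Suc by (auto simp: atLeastAtMostSuc_conv)
  finally show ?case .
qed simp

lemma digits_value_surj:
  assumes "0 \<le> a" and "a < int B ^ k"
  shows "\<exists>f. (\<forall>\<rho>\<in>{1..k}. f \<rho> \<in> R B) \<and> digits_value B f k = a"
  using assms
proof (induction k arbitrary: a)
  case (Suc k)
  have B: "int B > 0"
    using Suc.prems by (cases "B = 0") auto
  have "a div int B < int B ^ k"
  proof -
    have "a div int B * int B \<le> a"
      using div_mult_mod_eq[of a "int B"] pos_mod_sign[OF B, of a] by linarith
    also have "a < int B ^ k * int B"
      using Suc.prems by (simp add: mult.commute)
    finally show ?thesis
      using B by simp
  qed
  moreover have "0 \<le> a div int B"
    using Suc.prems B by (simp add: pos_imp_zdiv_nonneg_iff)
  ultimately obtain f where f: "\<forall>\<rho>\<in>{1..k}. f \<rho> \<in> R B" "digits_value B f k = a div int B"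
    using Suc.IH by blast
  let ?g = "f(Suc k := a mod int B)"
  have "digits_value B ?g k = digits_value B f k"
    by (rule digits_value_cong) auto
  then have "digits_value B ?g (Suc k) = a"
    using f(2) by simp
  moreover have "\<forall>\<rho>\<in>{1..Suc k}. ?g \<rho> \<in> R B"
    using f(1) B by (auto simp: R_def)
  ultimately show ?case by blast
qed simp

lemma digits_value_add_div:
  assumes "\<forall>\<rho>\<in>{1..k + j}. f \<rho> \<in> R B"
  shows "digits_value B f (k + j) div int B ^ j = digits_value B f k"
  using assms
proof (induction j)
  case (Suc j)
  have f: "0 \<le> f (Suc (k + j))" "f (Suc (k + j)) < int B"
    using Suc.prems by (auto simp: R_def)
  have "digits_value B f (k + Suc j) div int B ^ Suc j
        = (digits_value B f (k + j) * int B + f (Suc (k + j))) div int B div int B ^ j"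
    by (simp add: zdiv_zmult2_eq)
  also have "\<dots> = digits_value B f (k + j) div int B ^ j"
    using f by simp
  finally show ?case using Suc by simp
qed simp

lemma floor_finite_expansion:
  assumes "B > 0" and "k \<le> l" and "\<forall>\<rho>\<in>{1..l}. f \<rho> \<in> R B"
  shows "\<lfloor>real_of_int (digits_value B f l) / real B ^ l * real B ^ k\<rfloor> = digits_value B f k"
proof -
  obtain j where l: "l = k + j"
    using assms(2) le_Suc_ex by blast
  have "real_of_int (digits_value B f l) / real B ^ l * real B ^ k
        = real_of_int (digits_value B f l) / real_of_int (int B ^ j)"
    using assms(1) by (simp add: l power_add)
  then show ?thesis
    using digits_value_add_div assms(3) unfolding l
    by (simp only: floor_divide_of_int_eq)
qed

text \<open>Reading off the digits of \<open>x\<close> recovers its truncations because truncating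
  \<open>\<lfloor>x B ^ (k + 1)\<rfloor>\<close> once more, by dividing by \<open>B\<close>, gives \<open>\<lfloor>x B ^ k\<rfloor>\<close>.\<close>

lemma floor_eq_digits_value:
  assumes "B > 0" and "0 \<le> x" and "x < 1"
  shows "\<lfloor>x * real B ^ k\<rfloor> = digits_value B (\<lambda>\<rho>. \<lfloor>x * real B ^ \<rho>\<rfloor> mod int B) k"
proof (induction k)
  case 0
  then show ?case using assms by (simp add: floor_eq_iff)
next
  case (Suc k)
  have "\<lfloor>x * real B ^ Suc k\<rfloor> div int B = \<lfloor>x * real B ^ Suc k / real_of_int (int B)\<rfloor>"
    by (intro floor_divide_real_eq_div[symmetric]) simp
  also have "x * real B ^ Suc k / real_of_int (int B) = x * real B ^ k"
    using assms(1) by simp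
  finally have "\<lfloor>x * real B ^ Suc k\<rfloor> div int B = \<lfloor>x * real B ^ k\<rfloor>" .
  then show ?case
    using Suc div_mult_mod_eq[of "\<lfloor>x * real B ^ Suc k\<rfloor>" "int B"] by simp
qed

section \<open>Elementary intervals\<close>

lemma lebesgue_vol_elementary_interval:
  assumes "b > 0"
  shows "lebesgue_vol s (elementary_interval b s d a) = 1 / real b ^ (\<Sum>i\<in>{1..s}. d i)"
proof -
  interpret product_sigma_finite "\<lambda>_. lborel :: real measure"
    by standard
  have "emeasure (\<Pi>\<^sub>M i\<in>{1..s}. lborel) (elementary_interval b s d a)
        = (\<Prod>i\<in>{1..s}. emeasure lborel
             {real (a i) / real b ^ d i ..< (real (a i) + 1) / real b ^ d i})"
    unfolding elementary_interval_def by (rule emeasure_PiM) auto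
  also have "\<dots> = (\<Prod>i\<in>{1..s}. ennreal (1 / real b ^ d i))"
    using assms by (intro prod.cong) (auto simp: divide_right_mono simp flip: diff_divide_distrib)
  also have "\<dots> = ennreal (\<Prod>i\<in>{1..s}. 1 / real b ^ d i)"
    by (rule prod_ennreal) auto
  also have "(\<Prod>i\<in>{1..s}. 1 / real b ^ d i) = 1 / real b ^ (\<Sum>i\<in>{1..s}. d i)"
    by (simp add: prod_dividef power_sum)
  finally show ?thesis
    unfolding lebesgue_vol_def by (intro measure_eq_emeasure_eq_ennreal) auto
qed

lemma mem_elementary_interval_iff:
  assumes "b > 0" and "x \<in> unit_cube s"
  shows "x \<in> elementary_interval b s d a \<longleftrightarrow> (\<forall>i\<in>{1..s}. \<lfloor>x i * real b ^ d i\<rfloor> = int (a i))"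
proof -
  have "x i \<in> {real (a i) / real b ^ d i ..< (real (a i) + 1) / real b ^ d i}
        \<longleftrightarrow> \<lfloor>x i * real b ^ d i\<rfloor> = int (a i)" for i
    using assms(1) by (auto simp: floor_eq_iff field_simps)
  then show ?thesis
    using assms(2) unfolding elementary_interval_def unit_cube_def by (auto simp: PiE_iff)
qed

lemma volume_bound_iff:
  assumes "b \<ge> 2" and "u \<le> m"
  shows "real b powi (int u - int m) \<le> 1 / real b ^ k \<longleftrightarrow> k \<le> m - u"
proof -
  have "int u - int m = - int (m - u)"
    using assms(2) by simp
  then have powi: "real b powi (int u - int m) = 1 / real b ^ (m - u)"
    by (simp only: power_int_minus power_int_of_nat inverse_eq_divide)
  have "real b powi (int u - int m) \<le> 1 / real b ^ k \<longleftrightarrow> real b ^ k \<le> real b ^ (m - u)"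
    unfolding powi using assms(1) by (simp add: divide_simps)
  then show ?thesis
    using assms(1) by simp
qed

section \<open>Both counting conditions in a common form\<close>

lemma is_net_iff_floor_counts:
  assumes "b \<ge> 2" and "s \<ge> 1" and "u \<le> m" and "\<forall>i\<in>{1..s}. e i \<ge> 1"
  shows "is_net u m e s b P \<longleftrightarrow>
    (\<forall>n\<in>{1..b ^ m}. P n \<in> unit_cube s) \<and>
    (\<forall>\<kappa> a. (\<Sum>i\<in>{1..s}. \<kappa> i * e i) \<le> m - u \<longrightarrow>
       (\<forall>i\<in>{1..s}. a i < (b ^ e i) ^ \<kappa> i) \<longrightarrow>
       real (card {n\<in>{1..b ^ m}. \<forall>i\<in>{1..s}. \<lfloor>P n i * real (b ^ e i) ^ \<kappa> i\<rfloor> = int (a i)})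
         = real b ^ m / real b ^ (\<Sum>i\<in>{1..s}. \<kappa> i * e i))"
    (is "_ \<longleftrightarrow> ?cube \<and> ?counts")
proof -
  have pow: "(b ^ e i) ^ \<kappa> i = b ^ (\<kappa> i * e i)" for \<kappa> i
    by (simp add: mult.commute flip: power_mult)
  have rpow: "real (b ^ e i) ^ \<kappa> i = real b ^ (\<kappa> i * e i)" for \<kappa> i
    by (simp add: mult.commute flip: power_mult)
  have "is_net u m e s b P \<longleftrightarrow> ?cube \<and>
     (\<forall>d a. (\<forall>i\<in>{1..s}. a i < b ^ d i \<and> e i dvd d i) \<longrightarrow> (\<Sum>i\<in>{1..s}. d i) \<le> m - u \<longrightarrow>
        real (card {n\<in>{1..b ^ m}. P n \<in> elementary_interval b s d a})
          = real b ^ m / real b ^ (\<Sum>i\<in>{1..s}. d i))"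
    (is "_ \<longleftrightarrow> ?cube \<and> ?intervals")
    using assms lebesgue_vol_elementary_interval[of b s] volume_bound_iff[of b u m]
    unfolding is_net_def by simp
  moreover have "?intervals \<longleftrightarrow> ?counts" if cube: ?cube
  proof -
    have set_eq: "{n\<in>{1..b ^ m}. P n \<in> elementary_interval b s d a}
        = {n\<in>{1..b ^ m}. \<forall>i\<in>{1..s}. \<lfloor>P n i * real (b ^ e i) ^ \<kappa> i\<rfloor> = int (a i)}"
      if "\<forall>i\<in>{1..s}. d i = \<kappa> i * e i" for d \<kappa> a
      using that cube assms(1) mem_elementary_interval_iff[of b] unfolding rpow by auto
    show ?thesis
    proof (intro iffI allI impI)
      fix \<kappa> a :: "nat \<Rightarrow> nat"
      assume I: ?intervals and le: "(\<Sum>i\<in>{1..s}. \<kappa> i * e i) \<le> m - u"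
        and "\<forall>i\<in>{1..s}. a i < (b ^ e i) ^ \<kappa> i"
      then have a: "\<forall>i\<in>{1..s}. a i < b ^ (\<kappa> i * e i) \<and> e i dvd \<kappa> i * e i"
        unfolding pow by simp
      have "real (card {n\<in>{1..b ^ m}. P n \<in> elementary_interval b s (\<lambda>i. \<kappa> i * e i) a})
         = real b ^ m / real b ^ (\<Sum>i\<in>{1..s}. \<kappa> i * e i)"
        by (rule I[THEN spec, of "\<lambda>i. \<kappa> i * e i", THEN spec, THEN mp, OF a, THEN mp, OF le])
      then show "real (card {n\<in>{1..b ^ m}. \<forall>i\<in>{1..s}. \<lfloor>P n i * real (b ^ e i) ^ \<kappa> i\<rfloor> = int (a i)})
         = real b ^ m / real b ^ (\<Sum>i\<in>{1..s}. \<kappa> i * e i)"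
        by (subst (asm) set_eq[of _ \<kappa>]) simp_all
    next
      fix d a :: "nat \<Rightarrow> nat"
      assume C: ?counts and d: "\<forall>i\<in>{1..s}. a i < b ^ d i \<and> e i dvd d i"
        and le: "(\<Sum>i\<in>{1..s}. d i) \<le> m - u"
      define \<kappa> where "\<kappa> i = d i div e i" for i
      have \<kappa>: "\<forall>i\<in>{1..s}. d i = \<kappa> i * e i"
        using d by (simp add: \<kappa>_def)
      then have sum: "(\<Sum>i\<in>{1..s}. d i) = (\<Sum>i\<in>{1..s}. \<kappa> i * e i)"
        by (intro sum.cong) auto
      have "\<forall>i\<in>{1..s}. a i < (b ^ e i) ^ \<kappa> i"
        using d \<kappa> unfolding pow by auto
      then show "real (card {n\<in>{1..b ^ m}. P n \<in> elementary_interval b s d a})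
          = real b ^ m / real b ^ (\<Sum>i\<in>{1..s}. d i)"
        using C le unfolding set_eq[OF \<kappa>] sum by blast
    qed
  qed
  ultimately show ?thesis by blast
qed

text \<open>
  A selection of columns from the blocks in \<open>I\<close> is a selection from all blocks with \<open>\<kappa> i = 0\<close> outside
  \<open>I\<close>. The selection of no columns at all is new in this form, but then the count is that of all
  rows.
\<close>

lemma is_mixed_OOA_iff_full_counts:
  assumes "b \<ge> 2" and "s \<ge> 1" and "u \<le> m" and "\<forall>i\<in>{1..s}. e i \<ge> 1"
    and "\<forall>i\<in>{1..s}. 1 \<le> \<beta> i \<and> \<beta> i \<le> (m - u) div e i"
  shows "is_mixed_OOA b m u e s \<beta> Z \<longleftrightarrow>
    (\<forall>i\<in>{1..s}. \<forall>\<rho>\<in>{1..\<beta> i}. \<forall>n\<in>{1..b ^ m}. Z i \<rho> n \<in> R (b ^ e i)) \<and>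
    (\<forall>\<kappa> c. (\<forall>i\<in>{1..s}. \<kappa> i \<le> \<beta> i) \<longrightarrow> (\<Sum>i\<in>{1..s}. \<kappa> i * e i) \<le> m - u \<longrightarrow>
       (\<forall>i\<in>{1..s}. \<forall>\<rho>\<in>{1..\<kappa> i}. c i \<rho> \<in> R (b ^ e i)) \<longrightarrow>
       real (card {n\<in>{1..b ^ m}. \<forall>i\<in>{1..s}. \<forall>\<rho>\<in>{1..\<kappa> i}. Z i \<rho> n = c i \<rho>})
         = real b ^ m / real b ^ (\<Sum>i\<in>{1..s}. \<kappa> i * e i))"
    (is "_ \<longleftrightarrow> ?entries \<and> ?full")
proof -
  let ?sub = "\<forall>I \<kappa>. I \<noteq> {} \<longrightarrow> I \<subseteq> {1..s} \<longrightarrow>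
        (\<forall>i\<in>I. 1 \<le> \<kappa> i \<and> \<kappa> i \<le> \<beta> i) \<longrightarrow> (\<Sum>i\<in>I. \<kappa> i * e i) \<le> m - u \<longrightarrow>
        (\<forall>c. (\<forall>i\<in>I. \<forall>\<rho>\<in>{1..\<kappa> i}. c i \<rho> \<in> R (b ^ e i)) \<longrightarrow>
           real (card {n\<in>{1..b ^ m}. \<forall>i\<in>I. \<forall>\<rho>\<in>{1..\<kappa> i}. Z i \<rho> n = c i \<rho>}) =
             real b ^ m / real b ^ (\<Sum>i\<in>I. \<kappa> i * e i))"
  have sub_iff: "?sub \<longleftrightarrow> ?full"
  proof (intro iffI allI impI)
    fix \<kappa> :: "nat \<Rightarrow> nat" and c :: "nat \<Rightarrow> nat \<Rightarrow> int"
    assume S: ?sub and \<kappa>: "\<forall>i\<in>{1..s}. \<kappa> i \<le> \<beta> i" and le: "(\<Sum>i\<in>{1..s}. \<kappa> i * e i) \<le> m - u"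
      and c: "\<forall>i\<in>{1..s}. \<forall>\<rho>\<in>{1..\<kappa> i}. c i \<rho> \<in> R (b ^ e i)"
    define I where "I = {i\<in>{1..s}. \<kappa> i \<noteq> 0}"
    have sum: "(\<Sum>i\<in>{1..s}. \<kappa> i * e i) = (\<Sum>i\<in>I. \<kappa> i * e i)"
      by (rule sum.mono_neutral_right) (auto simp: I_def)
    have set_eq: "{n\<in>{1..b ^ m}. \<forall>i\<in>{1..s}. \<forall>\<rho>\<in>{1..\<kappa> i}. Z i \<rho> n = c i \<rho>}
        = {n\<in>{1..b ^ m}. \<forall>i\<in>I. \<forall>\<rho>\<in>{1..\<kappa> i}. Z i \<rho> n = c i \<rho>}"
      by (fastforce simp: I_def)
    show "real (card {n\<in>{1..b ^ m}. \<forall>i\<in>{1..s}. \<forall>\<rho>\<in>{1..\<kappa> i}. Z i \<rho> n = c i \<rho>})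
         = real b ^ m / real b ^ (\<Sum>i\<in>{1..s}. \<kappa> i * e i)"
    proof (cases "I = {}")
      case True
      then show ?thesis unfolding set_eq sum by (simp flip: atLeastAtMost_def atLeastAtMost_iff)
    next
      case False
      moreover have "I \<subseteq> {1..s}" "\<forall>i\<in>I. 1 \<le> \<kappa> i \<and> \<kappa> i \<le> \<beta> i"
        "\<forall>i\<in>I. \<forall>\<rho>\<in>{1..\<kappa> i}. c i \<rho> \<in> R (b ^ e i)"
        using \<kappa> c by (auto simp: I_def)
      ultimately show ?thesis
        using S le unfolding set_eq sum by blast
    qed
  next
    fix I :: "nat set" and \<kappa> :: "nat \<Rightarrow> nat" and c :: "nat \<Rightarrow> nat \<Rightarrow> int"
    assume F: ?full and I: "I \<subseteq> {1..s}" and \<kappa>: "\<forall>i\<in>I. 1 \<le> \<kappa> i \<and> \<kappa> i \<le> \<beta> i"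
      and le: "(\<Sum>i\<in>I. \<kappa> i * e i) \<le> m - u"
      and c: "\<forall>i\<in>I. \<forall>\<rho>\<in>{1..\<kappa> i}. c i \<rho> \<in> R (b ^ e i)"
    define \<kappa>' where "\<kappa>' i = (if i \<in> I then \<kappa> i else 0)" for i
    have sum: "(\<Sum>i\<in>{1..s}. \<kappa>' i * e i) = (\<Sum>i\<in>I. \<kappa> i * e i)"
      using I by (intro sum.mono_neutral_cong_right) (auto simp: \<kappa>'_def)
    have set_eq: "{n\<in>{1..b ^ m}. \<forall>i\<in>{1..s}. \<forall>\<rho>\<in>{1..\<kappa>' i}. Z i \<rho> n = c i \<rho>}
        = {n\<in>{1..b ^ m}. \<forall>i\<in>I. \<forall>\<rho>\<in>{1..\<kappa> i}. Z i \<rho> n = c i \<rho>}"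
      using I by (auto simp: \<kappa>'_def split: if_splits)
    have "\<forall>i\<in>{1..s}. \<kappa>' i \<le> \<beta> i" "\<forall>i\<in>{1..s}. \<forall>\<rho>\<in>{1..\<kappa>' i}. c i \<rho> \<in> R (b ^ e i)"
      using \<kappa> c by (auto simp: \<kappa>'_def)
    then show "real (card {n\<in>{1..b ^ m}. \<forall>i\<in>I. \<forall>\<rho>\<in>{1..\<kappa> i}. Z i \<rho> n = c i \<rho>})
        = real b ^ m / real b ^ (\<Sum>i\<in>I. \<kappa> i * e i)"
      using F le unfolding set_eq[symmetric] sum[symmetric] by blast
  qed
  show ?thesis
    unfolding is_mixed_OOA_def by (simp only: assms[THEN eqTrueI] sub_iff simp_thms)
qed

section \<open>Nets and arrays with the same digits\<close>

text \<open>The floors, rather than digits, of the coordinates are compared, because a floor condition is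
  what membership in an elementary interval amounts to.\<close>

definition same_digits ::
    "nat \<Rightarrow> nat \<Rightarrow> (nat \<Rightarrow> nat) \<Rightarrow> nat \<Rightarrow> (nat \<Rightarrow> nat) \<Rightarrow>
     (nat \<Rightarrow> nat \<Rightarrow> real) \<Rightarrow> (nat \<Rightarrow> nat \<Rightarrow> nat \<Rightarrow> int) \<Rightarrow> bool" where
  "same_digits b m e s \<beta> P Z \<longleftrightarrow>
     (\<forall>n\<in>{1..b ^ m}. P n \<in> unit_cube s) \<and>
     (\<forall>i\<in>{1..s}. \<forall>\<rho>\<in>{1..\<beta> i}. \<forall>n\<in>{1..b ^ m}. Z i \<rho> n \<in> R (b ^ e i)) \<and>
     (\<forall>n\<in>{1..b ^ m}. \<forall>i\<in>{1..s}. \<forall>k\<le>\<beta> i.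
        \<lfloor>P n i * real (b ^ e i) ^ k\<rfloor> = digits_value (b ^ e i) (\<lambda>\<rho>. Z i \<rho> n) k)"

text \<open>
  Numbers \<open>a i < (b ^ e i) ^ \<kappa> i\<close> correspond to tuples of \<open>\<kappa> i\<close> digits, so the intervals of the net
  correspond to the tuples of the array; the same indices \<open>n\<close> are counted on both sides.
\<close>

lemma is_net_iff_is_mixed_OOA:
  assumes "b \<ge> 2" and "s \<ge> 1" and "u \<le> m" and e: "\<forall>i\<in>{1..s}. e i \<ge> 1"
    and \<beta>: "\<forall>i\<in>{1..s}. 1 \<le> \<beta> i \<and> \<beta> i = (m - u) div e i"
    and same: "same_digits b m e s \<beta> P Z"
  shows "is_net u m e s b P \<longleftrightarrow> is_mixed_OOA b m u e s \<beta> Z"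
proof -
  have cube: "\<forall>n\<in>{1..b ^ m}. P n \<in> unit_cube s"
    and Z: "\<forall>i\<in>{1..s}. \<forall>\<rho>\<in>{1..\<beta> i}. \<forall>n\<in>{1..b ^ m}. Z i \<rho> n \<in> R (b ^ e i)"
    and floor: "\<And>n i k. n \<in> {1..b ^ m} \<Longrightarrow> i \<in> {1..s} \<Longrightarrow> k \<le> \<beta> i \<Longrightarrow>
        \<lfloor>P n i * real (b ^ e i) ^ k\<rfloor> = digits_value (b ^ e i) (\<lambda>\<rho>. Z i \<rho> n) k"
    using same unfolding same_digits_def by blast+
  have \<kappa>_le: "\<forall>i\<in>{1..s}. \<kappa> i \<le> \<beta> i" if "(\<Sum>i\<in>{1..s}. \<kappa> i * e i) \<le> m - u" for \<kappa>
  proof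
    fix i assume i: "i \<in> {1..s}"
    then have "\<kappa> i * e i \<le> (\<Sum>i\<in>{1..s}. \<kappa> i * e i)"
      by (intro member_le_sum) auto
    with that have "\<kappa> i * e i \<le> m - u" by simp
    then show "\<kappa> i \<le> \<beta> i"
      using \<beta> e i by (auto simp: less_eq_div_iff_mult_less_eq Suc_le_eq)
  qed
  have set_eq: "{n\<in>{1..b ^ m}. \<forall>i\<in>{1..s}. \<lfloor>P n i * real (b ^ e i) ^ \<kappa> i\<rfloor> = int (a i)}
      = {n\<in>{1..b ^ m}. \<forall>i\<in>{1..s}. \<forall>\<rho>\<in>{1..\<kappa> i}. Z i \<rho> n = c i \<rho>}"
    if \<kappa>: "\<forall>i\<in>{1..s}. \<kappa> i \<le> \<beta> i"
      and c: "\<forall>i\<in>{1..s}. \<forall>\<rho>\<in>{1..\<kappa> i}. c i \<rho> \<in> R (b ^ e i)"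
      and a: "\<forall>i\<in>{1..s}. int (a i) = digits_value (b ^ e i) (c i) (\<kappa> i)" for \<kappa> a c
  proof -
    have "\<lfloor>P n i * real (b ^ e i) ^ \<kappa> i\<rfloor> = int (a i) \<longleftrightarrow> (\<forall>\<rho>\<in>{1..\<kappa> i}. Z i \<rho> n = c i \<rho>)"
      if n: "n \<in> {1..b ^ m}" and i: "i \<in> {1..s}" for n i
    proof -
      have "\<forall>\<rho>\<in>{1..\<kappa> i}. Z i \<rho> n \<in> R (b ^ e i)"
      proof
        fix \<rho> assume "\<rho> \<in> {1..\<kappa> i}"
        moreover have "\<kappa> i \<le> \<beta> i" using \<kappa> i by blast
        ultimately have "\<rho> \<in> {1..\<beta> i}" by simp
        then show "Z i \<rho> n \<in> R (b ^ e i)" using Z n i by blast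
      qed
      moreover have "\<forall>\<rho>\<in>{1..\<kappa> i}. c i \<rho> \<in> R (b ^ e i)"
        using c i by blast
      ultimately show ?thesis
        using floor[OF n i] \<kappa> a i
          digits_value_eq_iff[of "\<kappa> i" "\<lambda>\<rho>. Z i \<rho> n" "b ^ e i" "c i"] by simp
    qed
    then show ?thesis by blast
  qed
  let ?floor_counts = "\<forall>\<kappa> a. (\<Sum>i\<in>{1..s}. \<kappa> i * e i) \<le> m - u \<longrightarrow>
       (\<forall>i\<in>{1..s}. a i < (b ^ e i) ^ \<kappa> i) \<longrightarrow>
       real (card {n\<in>{1..b ^ m}. \<forall>i\<in>{1..s}. \<lfloor>P n i * real (b ^ e i) ^ \<kappa> i\<rfloor> = int (a i)})
         = real b ^ m / real b ^ (\<Sum>i\<in>{1..s}. \<kappa> i * e i)"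
  let ?full_counts = "\<forall>\<kappa> c. (\<forall>i\<in>{1..s}. \<kappa> i \<le> \<beta> i) \<longrightarrow> (\<Sum>i\<in>{1..s}. \<kappa> i * e i) \<le> m - u \<longrightarrow>
       (\<forall>i\<in>{1..s}. \<forall>\<rho>\<in>{1..\<kappa> i}. c i \<rho> \<in> R (b ^ e i)) \<longrightarrow>
       real (card {n\<in>{1..b ^ m}. \<forall>i\<in>{1..s}. \<forall>\<rho>\<in>{1..\<kappa> i}. Z i \<rho> n = c i \<rho>})
         = real b ^ m / real b ^ (\<Sum>i\<in>{1..s}. \<kappa> i * e i)"
  have counts_iff: "?floor_counts \<longleftrightarrow> ?full_counts"
  proof (intro iffI allI impI)
    fix \<kappa> :: "nat \<Rightarrow> nat" and c :: "nat \<Rightarrow> nat \<Rightarrow> int"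
    assume F: ?floor_counts and \<kappa>: "\<forall>i\<in>{1..s}. \<kappa> i \<le> \<beta> i"
      and le: "(\<Sum>i\<in>{1..s}. \<kappa> i * e i) \<le> m - u"
      and c: "\<forall>i\<in>{1..s}. \<forall>\<rho>\<in>{1..\<kappa> i}. c i \<rho> \<in> R (b ^ e i)"
    define a where "a i = nat (digits_value (b ^ e i) (c i) (\<kappa> i))" for i
    have bounds: "0 \<le> digits_value (b ^ e i) (c i) (\<kappa> i) \<and>
        digits_value (b ^ e i) (c i) (\<kappa> i) < int (b ^ e i) ^ \<kappa> i" if "i \<in> {1..s}" for i
      using c that by (intro digits_value_bounds) blast
    then have a: "\<forall>i\<in>{1..s}. int (a i) = digits_value (b ^ e i) (c i) (\<kappa> i)"
      by (simp add: a_def)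
    have "\<forall>i\<in>{1..s}. a i < (b ^ e i) ^ \<kappa> i"
    proof
      fix i assume i: "i \<in> {1..s}"
      then have "int (a i) < int ((b ^ e i) ^ \<kappa> i)"
        using a bounds[OF i] by simp
      then show "a i < (b ^ e i) ^ \<kappa> i" by (simp only: of_nat_less_iff)
    qed
    then show "real (card {n\<in>{1..b ^ m}. \<forall>i\<in>{1..s}. \<forall>\<rho>\<in>{1..\<kappa> i}. Z i \<rho> n = c i \<rho>})
         = real b ^ m / real b ^ (\<Sum>i\<in>{1..s}. \<kappa> i * e i)"
      using F le unfolding set_eq[OF \<kappa> c a, symmetric] by blast
  next
    fix \<kappa> a :: "nat \<Rightarrow> nat"
    assume F: ?full_counts and le: "(\<Sum>i\<in>{1..s}. \<kappa> i * e i) \<le> m - u"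
      and a_less: "\<forall>i\<in>{1..s}. a i < (b ^ e i) ^ \<kappa> i"
    have "\<forall>i\<in>{1..s}. \<exists>f. (\<forall>\<rho>\<in>{1..\<kappa> i}. f \<rho> \<in> R (b ^ e i)) \<and>
        digits_value (b ^ e i) f (\<kappa> i) = int (a i)"
    proof
      fix i assume "i \<in> {1..s}"
      then have "int (a i) < int ((b ^ e i) ^ \<kappa> i)"
        using a_less by (simp only: of_nat_less_iff)
      then show "\<exists>f. (\<forall>\<rho>\<in>{1..\<kappa> i}. f \<rho> \<in> R (b ^ e i)) \<and>
          digits_value (b ^ e i) f (\<kappa> i) = int (a i)"
        by (intro digits_value_surj) auto
    qed
    from bchoice[OF this] obtain c
      where c: "\<forall>i\<in>{1..s}. \<forall>\<rho>\<in>{1..\<kappa> i}. c i \<rho> \<in> R (b ^ e i)"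
        and a: "\<forall>i\<in>{1..s}. int (a i) = digits_value (b ^ e i) (c i) (\<kappa> i)"
      by metis
    show "real (card {n\<in>{1..b ^ m}. \<forall>i\<in>{1..s}. \<lfloor>P n i * real (b ^ e i) ^ \<kappa> i\<rfloor> = int (a i)})
         = real b ^ m / real b ^ (\<Sum>i\<in>{1..s}. \<kappa> i * e i)"
      using F le c \<kappa>_le[OF le] unfolding set_eq[OF \<kappa>_le[OF le] c a] by blast
  qed
  have \<beta>_le: "\<forall>i\<in>{1..s}. 1 \<le> \<beta> i \<and> \<beta> i \<le> (m - u) div e i"
    using \<beta> by auto
  show ?thesis
    unfolding is_net_iff_floor_counts[OF assms(1-4)]
      is_mixed_OOA_iff_full_counts[OF assms(1-4) \<beta>_le]
    by (simp only: cube[THEN eqTrueI] Z[THEN eqTrueI] counts_iff simp_thms)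
qed

lemma same_digits_of_points:
  assumes "b > 0" and "\<forall>n\<in>{1..b ^ m}. P n \<in> unit_cube s"
  shows "same_digits b m e s \<beta> P (\<lambda>i \<rho> n. \<lfloor>P n i * real (b ^ e i) ^ \<rho>\<rfloor> mod int (b ^ e i))"
proof -
  have "0 \<le> P n i \<and> P n i < 1" if "n \<in> {1..b ^ m}" "i \<in> {1..s}" for n i
    using assms(2) that by (auto simp: unit_cube_def PiE_iff)
  then have "\<lfloor>P n i * real (b ^ e i) ^ k\<rfloor>
      = digits_value (b ^ e i) (\<lambda>\<rho>. \<lfloor>P n i * real (b ^ e i) ^ \<rho>\<rfloor> mod int (b ^ e i)) k"
    if "n \<in> {1..b ^ m}" "i \<in> {1..s}" for n i k
    using assms(1) that by (intro floor_eq_digits_value) auto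
  moreover have "y mod int (b ^ e i) \<in> R (b ^ e i)" for y i
    using assms(1) by (simp add: R_def)
  ultimately show ?thesis
    using assms(2) unfolding same_digits_def by blast
qed

lemma same_digits_of_array:
  assumes "b > 0"
    and Z: "\<forall>i\<in>{1..s}. \<forall>\<rho>\<in>{1..\<beta> i}. \<forall>n\<in>{1..b ^ m}. Z i \<rho> n \<in> R (b ^ e i)"
  shows "same_digits b m e s \<beta>
    (\<lambda>n. \<lambda>i\<in>{1..s}. real_of_int (digits_value (b ^ e i) (\<lambda>\<rho>. Z i \<rho> n) (\<beta> i)) /
                     real (b ^ e i) ^ \<beta> i) Z"
    (is "same_digits b m e s \<beta> ?P Z")
proof -
  have row: "\<forall>\<rho>\<in>{1..\<beta> i}. Z i \<rho> n \<in> R (b ^ e i)" if "n \<in> {1..b ^ m}" "i \<in> {1..s}" for n i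
    using Z that by blast
  have "?P n i \<in> {0..<1}" if n: "n \<in> {1..b ^ m}" and i: "i \<in> {1..s}" for n i
  proof -
    let ?v = "digits_value (b ^ e i) (\<lambda>\<rho>. Z i \<rho> n) (\<beta> i)"
    have v: "0 \<le> ?v" "?v < int (b ^ e i) ^ \<beta> i"
      using digits_value_bounds[OF row[OF n i]] by auto
    have "real_of_int ?v < real_of_int (int (b ^ e i) ^ \<beta> i)"
      using v(2) by (simp only: of_int_less_iff)
    then show ?thesis
      using v(1) assms(1) i by simp
  qed
  then have "\<forall>n\<in>{1..b ^ m}. ?P n \<in> unit_cube s"
    unfolding unit_cube_def by (auto simp: PiE_iff)
  moreover have "\<lfloor>?P n i * real (b ^ e i) ^ k\<rfloor> = digits_value (b ^ e i) (\<lambda>\<rho>. Z i \<rho> n) k"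
    if "n \<in> {1..b ^ m}" "i \<in> {1..s}" "k \<le> \<beta> i" for n i k
    using floor_finite_expansion[OF _ that(3) row[OF that(1,2)]] assms(1) that(2) by simp
  ultimately show ?thesis
    using Z unfolding same_digits_def by blast
qed

theorem theorem5:
  fixes b s u m :: nat and e :: "nat \<Rightarrow> nat"
  assumes "b \<ge> 2" and "s \<ge> 2"
    and "\<forall>i\<in>{1..s}. e i \<ge> 1"
    and "\<forall>i\<in>{1..s}. \<forall>j\<in>{1..s}. i \<le> j \<longrightarrow> e i \<le> e j"
    and "m \<ge> u + e s"
  shows "(\<exists>P. is_net u m e s b P) \<longleftrightarrow>
         (\<exists>Z. is_mixed_OOA b m u e s (\<lambda>i. (m - u) div e i) Z)"
proof -
  let ?\<beta> = "\<lambda>i. (m - u) div e i"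
  have "e i \<le> m - u" if "i \<in> {1..s}" for i
  proof -
    have "e i \<le> e s" using assms(4) that by auto
    then show ?thesis using assms(5) by linarith
  qed
  then have \<beta>: "\<forall>i\<in>{1..s}. 1 \<le> ?\<beta> i \<and> ?\<beta> i = (m - u) div e i"
    using assms(3) by (auto simp: Suc_le_eq div_greater_zero_iff)
  have "b > 0" "s \<ge> 1" "u \<le> m" using assms by auto
  note iff = is_net_iff_is_mixed_OOA[OF assms(1) \<open>s \<ge> 1\<close> \<open>u \<le> m\<close> assms(3) \<beta>]
  show ?thesis
  proof
    assume "\<exists>P. is_net u m e s b P"
    then obtain P where P: "is_net u m e s b P" by blast
    then have "\<forall>n\<in>{1..b ^ m}. P n \<in> unit_cube s"
      unfolding is_net_def by blast
    with P show "\<exists>Z. is_mixed_OOA b m u e s ?\<beta> Z"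
      using iff[OF same_digits_of_points[OF \<open>b > 0\<close>]] by blast
  next
    assume "\<exists>Z. is_mixed_OOA b m u e s ?\<beta> Z"
    then obtain Z where Z: "is_mixed_OOA b m u e s ?\<beta> Z" by blast
    then have "\<forall>i\<in>{1..s}. \<forall>\<rho>\<in>{1..?\<beta> i}. \<forall>n\<in>{1..b ^ m}. Z i \<rho> n \<in> R (b ^ e i)"
      unfolding is_mixed_OOA_def by blast
    with Z show "\<exists>P. is_net u m e s b P"
      using iff[OF same_digits_of_array[OF \<open>b > 0\<close>]] by blast
  qed
qed

end
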